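(* Let $q\in(0,1)$, $\delta=q+q^{-1}$, and let $(M_2,\omega_q,A)$ be an undirected reflexive quantum graph. Then it is exactly one of the following, where matrices are with respect to the orthonormal basis $(e_{11}Q^{-1/2},e_{12}Q^{-1/2},e_{21}Q^{-1/2},e_{22}Q^{-1/2})$ of $L^2(M_2,\omega_q)$ and spectra are listed with multiplicity: 1) the trivial quantum graph $A_1=\mathrm{id}_{M_2}$, which is $1$-regular with $\mathrm{Spec}(A_1)=\{1,1,1,1\}$; 2) $A_2=\begin{pmatrix}q^{-1}\delta&0&0&0\\0&0&0&0\\0&0&0&0\\0&0&0&q\delta\end{pmatrix}$, which is irregular with $\mathrm{Spec}(A_2)=\{q^{-1}\delta,q\delta,0,0\}$; 3) $A_3=\begin{pmatrix}1&0&0&\delta\\0&1&0&0\\0&0&1&0\\\delta&0&0&1\end{pmatrix}$, which is irregular with $\mathrm{Spec}(A_3)=\{1+\delta,1,1,1-\delta\}$; 4) the complete quantum graph $A_4=\delta^2\omega_q(\cdot)1=\begin{pmatrix}q^{-1}\delta&0&0&\delta\\0&0&0&0\\0&0&0&0\\\delta&0&0&q\delta\end{pmatrix}$, which is $\delta^2$-regular with $\mathrm{Spec}(A_4)=\{\delta^2,0,0,0\}$.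
   Context: $M_2=M_2(\mathbb{C})$ with matrix units $e_{ij}$. The Powers state is $\omega_q=\mathrm{Tr}(Q\,\cdot)$ with $Q=\frac{1}{1+q^2}\begin{pmatrix}1&0\\0&q^2\end{pmatrix}$. $L^2(M_2,\omega_q)$ is $M_2$ with inner product $\langle x|y\rangle=\omega_q(x^*y)$; $\dagger$ denotes Hilbert adjoints with respect to this inner product (and $\omega_q\otimes\omega_q$ on $M_2\otimes M_2$). With $m:M_2\otimes M_2\to M_2$ the multiplication map, $mm^\dagger=\delta^2\mathrm{id}$ with $\delta=q+q^{-1}$. A quantum graph $(M_2,\omega_q,A)$ is a linear operator $A:M_2\to M_2$ with $m(A\otimes A)m^\dagger=\delta^2A$. It is undirected if $A(b^* )=A(b)^*$ for all $b$ and $A^\dagger=A$; reflexive if $m(A\otimes\mathrm{id})m^\dagger=\delta^2\mathrm{id}$; $d$-regular if $A1=d1$ and $\omega_qA=d\,\omega_q$; irregular if it is not $d$-regular for any $d$. *)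

theory Defs
  imports "HOL-Analysis.Analysis" "HOL-Computational_Algebra.Polynomial"
begin

type_synonym M2 = "complex^2^2"

text \<open>
  \<open>M\<^sub>2 \<otimes> M\<^sub>2\<close> is realised as the matrices indexed by \<open>2 \<times> 2\<close>, the elementary tensor
  \<open>x \<otimes> y\<close> being the Kronecker product.
\<close>

type_synonym M2M2 = "complex^(2 \<times> 2)^(2 \<times> 2)"

definition cscale :: "complex \<Rightarrow> complex^'n^'m \<Rightarrow> complex^'n^'m" (infixr "*\<^sub>M" 75)
  where "c *\<^sub>M x = map_matrix (\<lambda>a. c * a) x"

definition ctransp :: "complex^'n^'m \<Rightarrow> complex^'m^'n"
  where "ctransp x = map_matrix cnj (transpose x)"

definition matrix_unit :: "'m \<Rightarrow> 'n \<Rightarrow> complex^'n^'m"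
  where "matrix_unit i j = (\<chi> k l. if k = i \<and> l = j then 1 else 0)"

definition kron :: "M2 \<Rightarrow> M2 \<Rightarrow> M2M2"  (infixr "\<otimes>\<^sub>M" 72)
  where "x \<otimes>\<^sub>M y = (\<chi> r c. x $ fst r $ fst c * y $ snd r $ snd c)"

lemma vector_space_cscale: "vector_space (cscale :: complex \<Rightarrow> complex^'n^'m \<Rightarrow> _)"
  by unfold_locales (auto simp: cscale_def vec_eq_iff algebra_simps)

abbreviation clinear_map :: "(complex^'n^'m \<Rightarrow> complex^'k^'l) \<Rightarrow> bool"
  where "clinear_map \<equiv> Vector_Spaces.linear cscale cscale"


subsection \<open>The Powers state and its GNS inner products\<close>

definition Q_weight :: "real \<Rightarrow> 2 \<Rightarrow> real"
  where "Q_weight q i = (if i = 1 then 1 else q\<^sup>2) / (1 + q\<^sup>2)"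

text \<open>\<open>Q_power q s\<close> is \<open>Q\<^sup>s\<close>; since \<open>Q\<close> is diagonal with positive entries, powers are entrywise.\<close>

definition Q_power :: "real \<Rightarrow> real \<Rightarrow> M2"
  where "Q_power q s = (\<chi> i j. if i = j then complex_of_real (Q_weight q i powr s) else 0)"

definition Q_density :: "real \<Rightarrow> M2"
  where "Q_density q = (\<chi> i j. if i = j then complex_of_real (Q_weight q i) else 0)"

definition powers_state :: "real \<Rightarrow> M2 \<Rightarrow> complex"
  where "powers_state q x = trace (Q_density q ** x)"

text \<open>The sesquilinear form \<open>\<langle>x|y\<rangle> = \<rho>(x\<^sup>* y)\<close> for the functional \<open>\<rho> = Tr(R \<cdot>)\<close>.\<close>

definition gns_inner :: "complex^'n^'n \<Rightarrow> complex^'n^'n \<Rightarrow> complex^'n^'n \<Rightarrow> complex"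
  where "gns_inner R x y = trace (R ** (ctransp x ** y))"

abbreviation inner1 :: "real \<Rightarrow> M2 \<Rightarrow> M2 \<Rightarrow> complex"
  where "inner1 q \<equiv> gns_inner (Q_density q)"

text \<open>\<open>\<omega>\<^sub>q \<otimes> \<omega>\<^sub>q\<close> is the functional with density \<open>Q \<otimes> Q\<close>.\<close>

abbreviation inner2 :: "real \<Rightarrow> M2M2 \<Rightarrow> M2M2 \<Rightarrow> complex"
  where "inner2 q \<equiv> gns_inner (Q_density q \<otimes>\<^sub>M Q_density q)"

text \<open>As for the library's real \<^term>\<open>adjoint\<close>, the adjoint is chosen by its defining
  property; existence is shown at the end of this theory.\<close>

definition hilbert_adjoint ::
    "('v \<Rightarrow> 'v \<Rightarrow> complex) \<Rightarrow> ('w \<Rightarrow> 'w \<Rightarrow> complex) \<Rightarrow> ('v \<Rightarrow> 'w) \<Rightarrow> ('w \<Rightarrow> 'v)"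
  where "hilbert_adjoint ipV ipW f = (SOME g. \<forall>x y. ipW (f x) y = ipV x (g y))"


subsection \<open>Quantum graphs\<close>

text \<open>The coefficient of \<open>e\<^sub>i\<^sub>j \<otimes> e\<^sub>k\<^sub>l\<close> in \<open>T\<close> is \<open>T $ (i, k) $ (j, l)\<close>; both maps below extend
  their values on elementary tensors linearly.\<close>

definition tensor_mult :: "M2M2 \<Rightarrow> M2"
  where "tensor_mult T = (\<Sum>i\<in>UNIV. \<Sum>j\<in>UNIV. \<Sum>k\<in>UNIV. \<Sum>l\<in>UNIV.
           T $ (i, k) $ (j, l) *\<^sub>M (matrix_unit i j ** matrix_unit k l))"

definition tensor_map :: "(M2 \<Rightarrow> M2) \<Rightarrow> (M2 \<Rightarrow> M2) \<Rightarrow> M2M2 \<Rightarrow> M2M2"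
  where "tensor_map A B T = (\<Sum>i\<in>UNIV. \<Sum>j\<in>UNIV. \<Sum>k\<in>UNIV. \<Sum>l\<in>UNIV.
           T $ (i, k) $ (j, l) *\<^sub>M (A (matrix_unit i j) \<otimes>\<^sub>M B (matrix_unit k l)))"

definition mult_adj :: "real \<Rightarrow> M2 \<Rightarrow> M2M2"
  where "mult_adj q = hilbert_adjoint (inner2 q) (inner1 q) tensor_mult"

definition delta :: "real \<Rightarrow> real"
  where "delta q = q + inverse q"

definition quantum_graph :: "real \<Rightarrow> (M2 \<Rightarrow> M2) \<Rightarrow> bool"
  where "quantum_graph q A \<longleftrightarrow> clinear_map A \<and>
           tensor_mult \<circ> tensor_map A A \<circ> mult_adj q = (\<lambda>x. complex_of_real ((delta q)\<^sup>2) *\<^sub>M A x)"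

definition undirected :: "real \<Rightarrow> (M2 \<Rightarrow> M2) \<Rightarrow> bool"
  where "undirected q A \<longleftrightarrow> (\<forall>b. A (ctransp b) = ctransp (A b)) \<and>
           hilbert_adjoint (inner1 q) (inner1 q) A = A"

definition reflexive :: "real \<Rightarrow> (M2 \<Rightarrow> M2) \<Rightarrow> bool"
  where "reflexive q A \<longleftrightarrow>
           tensor_mult \<circ> tensor_map A id \<circ> mult_adj q = (\<lambda>x. complex_of_real ((delta q)\<^sup>2) *\<^sub>M x)"

definition regular :: "real \<Rightarrow> complex \<Rightarrow> (M2 \<Rightarrow> M2) \<Rightarrow> bool"
  where "regular q d A \<longleftrightarrow> A (mat 1) = d *\<^sub>M mat 1 \<and>
           powers_state q \<circ> A = (\<lambda>x. d * powers_state q x)"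

definition irregular :: "real \<Rightarrow> (M2 \<Rightarrow> M2) \<Rightarrow> bool"
  where "irregular q A \<longleftrightarrow> (\<nexists>d. regular q d A)"


subsection \<open>Matrices and spectra of operators\<close>

definition onb :: "real \<Rightarrow> M2^4"
  where "onb q = vector [matrix_unit 1 1 ** Q_power q (-1/2), matrix_unit 1 2 ** Q_power q (-1/2),
                         matrix_unit 2 1 ** Q_power q (-1/2), matrix_unit 2 2 ** Q_power q (-1/2)]"

definition op_matrix :: "real \<Rightarrow> (M2 \<Rightarrow> M2) \<Rightarrow> complex^4^4"
  where "op_matrix q A = (\<chi> i j. inner1 q (onb q $ i) (A (onb q $ j)))"

definition op_of_matrix :: "real \<Rightarrow> complex^4^4 \<Rightarrow> M2 \<Rightarrow> M2"
  where "op_of_matrix q B x =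
           (\<Sum>i\<in>UNIV. (\<Sum>j\<in>UNIV. B $ i $ j * inner1 q (onb q $ j) x) *\<^sub>M onb q $ i)"

definition charpoly :: "'a::comm_ring_1^'n^'n \<Rightarrow> 'a poly"
  where "charpoly B = det (mat [:0, 1:] - map_matrix (\<lambda>c. [:c:]) B)"

text \<open>Eigenvalues with (algebraic) multiplicity.\<close>

definition spectrum :: "real \<Rightarrow> (M2 \<Rightarrow> M2) \<Rightarrow> complex multiset"
  where "spectrum q A = proots (charpoly (op_matrix q A))"

subsection \<open>Well-definedness\<close>

text \<open>The linear extensions take the intended values on elementary tensors, the adjoints exist,
  \<open>m m\<^sup>\<dagger> = \<delta>\<^sup>2 id\<close>, and \<open>onb\<close> is an orthonormal basis.\<close>

lemma mult_kron: "tensor_mult (x \<otimes>\<^sub>M y) = x ** y"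
  by (simp add: tensor_mult_def kron_def vec_eq_iff forall_2 sum_2 cscale_def matrix_unit_def matrix_matrix_mult_def)

lemma matrix_unit_expand: "x = (\<Sum>i\<in>UNIV. \<Sum>j\<in>UNIV. x $ i $ j *\<^sub>M matrix_unit i j)" for x :: M2
  by (simp add: vec_eq_iff forall_2 sum_2 cscale_def matrix_unit_def)

lemma clinear_expand:
  assumes "clinear_map A"
  shows "A (x::M2) = (\<Sum>i\<in>UNIV. \<Sum>j\<in>UNIV. x $ i $ j *\<^sub>M A (matrix_unit i j))"
proof -
  interpret Vector_Spaces.linear cscale cscale A by (rule assms)
  show ?thesis by (subst matrix_unit_expand) (simp add: sum scale)
qed

lemma tensor_map_kron:
  assumes "clinear_map A" "clinear_map B"
  shows "tensor_map A B (x \<otimes>\<^sub>M y) = A x \<otimes>\<^sub>M B y"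
  unfolding tensor_map_def
  by (simp add: clinear_expand[OF assms(1), of x] clinear_expand[OF assms(2), of y] 
      kron_def vec_eq_iff forall_2 sum_2 cscale_def algebra_simps)

lemma Q_weight_pos: "0 < q \<Longrightarrow> 0 < Q_weight q i"
  by (auto simp: Q_weight_def intro!: divide_pos_pos add_pos_pos)

lemma sum_UNIV_prod: "(\<Sum>p\<in>UNIV. f p) = (\<Sum>i\<in>UNIV. \<Sum>j\<in>UNIV. f (i, j))"
  for f :: "'a::finite \<times> 'b::finite \<Rightarrow> complex"
  by (simp add: sum.cartesian_product flip: UNIV_Times_UNIV)

lemma inner1_eq: "inner1 q x y = (\<Sum>a\<in>UNIV. \<Sum>b\<in>UNIV. of_real (Q_weight q a) * (cnj (x $ b $ a) * y $ b $ a))"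
  by (simp add: gns_inner_def trace_def matrix_matrix_mult_def Q_density_def ctransp_def transpose_def sum_2 algebra_simps)

lemma inner2_eq: "inner2 q x y = (\<Sum>a\<in>UNIV. \<Sum>b\<in>UNIV. of_real (Q_weight q a * Q_weight q b) *
   (\<Sum>c\<in>UNIV. \<Sum>d\<in>UNIV. cnj (x $ (c,d) $ (a,b)) * y $ (c,d) $ (a,b)))"
  by (simp add: gns_inner_def trace_def kron_def matrix_matrix_mult_def Q_density_def ctransp_def transpose_def sum_UNIV_prod sum_2 algebra_simps)

definition mult_adj_expl :: "real \<Rightarrow> M2 \<Rightarrow> M2M2"
  where "mult_adj_expl q x = (\<chi> r c. if snd r = fst c then x $ fst r $ snd c / of_real (Q_weight q (fst c)) else 0)"

lemma inner1_tensor_mult: "0 < q \<Longrightarrow> inner1 q (tensor_mult T) y = inner2 q T (mult_adj_expl q y)"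
  using Q_weight_pos[of q 1] Q_weight_pos[of q 2]
  by (simp add: inner1_eq inner2_eq mult_adj_expl_def tensor_mult_def sum_2 cscale_def matrix_unit_def matrix_matrix_mult_def algebra_simps)

lemma inner2_matrix_unit:
  "inner2 q (matrix_unit (c,d) (a,b)) y = of_real (Q_weight q a * Q_weight q b) * y $ (c,d) $ (a,b)"
proof -
  have "\<forall>a b c d. inner2 q (matrix_unit (c,d) (a,b)) y =
      of_real (Q_weight q a * Q_weight q b) * y $ (c,d) $ (a,b)"
    by (simp add: inner2_eq matrix_unit_def forall_2 sum_2)
  thus ?thesis by blast
qed

lemma inner2_ext: assumes "0 < q" "\<And>x. inner2 q x y = inner2 q x z" shows "y = z"
proof -
  have "y $ (c,d) $ (a,b) = z $ (c,d) $ (a,b)" for a b c d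
    using assms(2)[of "matrix_unit (c,d) (a,b)"] Q_weight_pos[OF assms(1), of a] Q_weight_pos[OF assms(1), of b]
    by (simp add: inner2_matrix_unit)
  thus ?thesis by (simp add: vec_eq_iff)
qed

lemma mult_adj_eq: assumes "0 < q" shows "mult_adj q = mult_adj_expl q"
proof -
  have "\<forall>x y. inner1 q (tensor_mult x) y = inner2 q x (mult_adj q y)"
    unfolding mult_adj_def hilbert_adjoint_def by (rule someI[of _ "mult_adj_expl q"]) (simp add: inner1_tensor_mult assms)
  thus ?thesis using inner2_ext[OF assms] inner1_tensor_mult[OF assms] by (metis ext)
qed

lemma mult_mult_adj: assumes "0 < q" shows "tensor_mult (mult_adj q x) = complex_of_real ((delta q)\<^sup>2) *\<^sub>M x"
proof -
  have "1 / Q_weight q 1 + 1 / Q_weight q 2 = (delta q)\<^sup>2"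
    using assms by (simp add: Q_weight_def delta_def power2_eq_square field_simps)
  hence D: "complex_of_real ((delta q)\<^sup>2) = 1 / of_real (Q_weight q 1) + 1 / of_real(Q_weight q 2)"
    by (metis of_real_add of_real_divide of_real_1)
  show ?thesis
    unfolding D
    by (simp add: mult_adj_eq assms mult_adj_expl_def vec_eq_iff forall_2 sum_2 tensor_mult_def
        cscale_def matrix_unit_def matrix_matrix_mult_def algebra_simps)
qed

lemma vector_4:
  "(vector [a,b,c,d] :: 'a::zero^4) $ 1 = a" "(vector [a,b,c,d] :: 'a^4) $ 2 = b"
  "(vector [a,b,c,d] :: 'a^4) $ 3 = c" "(vector [a,b,c,d] :: 'a^4) $ 4 = d"
  unfolding vector_def by auto

lemma Q_weight_powr:
  assumes "0 < q"
  shows "of_real (Q_weight q k) * (of_real (Q_weight q k powr (-(1/2))) *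
           of_real (Q_weight q k powr (-(1/2)))) = (1::complex)" (is "?a * (?b * ?b) = _")
    and "of_real (Q_weight q k) * (of_real (Q_weight q k powr (-(1/2))) *
           (of_real (Q_weight q k powr (-(1/2))) * z)) = (z::complex)"
    and "of_real (Q_weight q k) * (z * (of_real (Q_weight q k powr (-(1/2))) *
           of_real (Q_weight q k powr (-(1/2))))) = (z::complex)"
proof -
  have "Q_weight q k powr (-(1/2)) * Q_weight q k powr (-(1/2)) = inverse (Q_weight q k)"
    using Q_weight_pos[OF assms, of k]
      powr_add[of "Q_weight q k" "-(1/2)" "-(1/2)"] by (simp add: powr_minus_divide inverse_eq_divide)
  hence "Q_weight q k * (Q_weight q k powr (-(1/2)) * Q_weight q k powr (-(1/2))) = 1"
    using Q_weight_pos[OF assms, of k] by simp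
  thus *: "?a * (?b * ?b) = 1"
    by (metis of_real_mult of_real_1)
  show "?a * (?b * (?b * z)) = z" "?a * (z * (?b * ?b)) = z"
    using arg_cong[OF *, of "\<lambda>t. t * z"] by (simp_all add: mult_ac)
qed

lemma onb_orthonormal: assumes "0 < q" shows "inner1 q (onb q $ i) (onb q $ j) = (if i = j then 1 else 0)"
proof -
  have "\<forall>i j. inner1 q (onb q $ i) (onb q $ j) = (if i = j then 1 else 0)"
    by (simp add: onb_def vector_4 inner1_eq sum_2 matrix_unit_def matrix_matrix_mult_def
        Q_power_def forall_4 Q_weight_powr assms mult_ac)
  thus ?thesis by blast
qed

lemma onb_expand:
  assumes "0 < q"
  shows "x = (\<Sum>i\<in>UNIV. inner1 q (onb q $ i) x *\<^sub>M onb q $ i)"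
  by (simp add: onb_def vector_4 inner1_eq sum_2 sum_4 matrix_unit_def matrix_matrix_mult_def
      Q_power_def cscale_def vec_eq_iff forall_2 mult_ac Q_weight_powr assms)

lemma inner1_lin: "inner1 q x (\<Sum>i\<in>UNIV. c i *\<^sub>M v i) = (\<Sum>i\<in>UNIV. c i * inner1 q x (v i))" for c :: "4 \<Rightarrow> _"
  by (simp add: inner1_eq sum_2 sum_4 cscale_def algebra_simps)

lemma op_matrix_of: assumes "0 < q" shows "op_matrix q (op_of_matrix q B) = B"
  by (simp add: op_matrix_def op_of_matrix_def inner1_lin onb_orthonormal assms vec_eq_iff if_distrib cong: if_cong)

lemma inner1_cnj: "cnj (inner1 q x y) = inner1 q y x"
  by (simp add: inner1_eq mult_ac)

lemma inner1_ext:
  assumes "0 < q" "\<And>x. inner1 q x y = inner1 q x z"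
  shows "y = z"
proof -
  have "y = (\<Sum>i\<in>UNIV. inner1 q (onb q $ i) y *\<^sub>M onb q $ i)"
    by (rule onb_expand[OF assms(1)])
  also have "\<dots> = (\<Sum>i\<in>UNIV. inner1 q (onb q $ i) z *\<^sub>M onb q $ i)"
    by (simp only: assms(2))
  also have "\<dots> = z"
    by (rule onb_expand[OF assms(1), symmetric])
  finally show ?thesis .
qed

lemma hilbert_adjoint_inner1:
  assumes "0 < q" "clinear_map A"
  shows "inner1 q (A x) y = inner1 q x (hilbert_adjoint (inner1 q) (inner1 q) A y)"
proof -
  interpret Vector_Spaces.linear cscale cscale A by (rule assms)
  define g where "g y = (\<Sum>i\<in>UNIV. inner1 q (A (onb q $ i)) y *\<^sub>M onb q $ i)" for y
  have "inner1 q (A x) y = inner1 q x (g y)" for x y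
  proof -
    have "A x = (\<Sum>i\<in>UNIV. inner1 q (onb q $ i) x *\<^sub>M A (onb q $ i))"
      by (rule trans[OF arg_cong[OF onb_expand[OF assms(1)], of A x]]) (simp only: sum scale)
    hence "inner1 q y (A x) = (\<Sum>i\<in>UNIV. inner1 q (onb q $ i) x * inner1 q y (A (onb q $ i)))"
      by (simp add: inner1_lin)
    hence "cnj (inner1 q y (A x)) = (\<Sum>i\<in>UNIV. cnj (inner1 q (onb q $ i) x * inner1 q y (A (onb q $ i))))"
      by simp
    thus ?thesis by (simp add: inner1_cnj g_def inner1_lin mult.commute)
  qed
  hence "\<forall>x y. inner1 q (A x) y = inner1 q x (g y)" by blast
  from someI[of "\<lambda>g. \<forall>x y. inner1 q (A x) y = inner1 q x (g y)", OF this]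
  show ?thesis unfolding hilbert_adjoint_def by blast
qed

end

theory Submission
  imports Defs
begin

text \<open>
  Write \<open>w\<^sub>i\<close> for the eigenvalues of \<open>Q\<close> and \<open>a\<^sub>i\<^sub>j\<^sub>,\<^sub>k\<^sub>l\<close> for the coefficient of \<open>e\<^sub>i\<^sub>j\<close> in \<open>A e\<^sub>k\<^sub>l\<close>.

  A map that is \<open>*\<close>-preserving and self-adjoint for \<open>\<omega>\<^sub>q\<close> is symmetric for the bilinear form
  \<open>(x, y) \<mapsto> \<omega>\<^sub>q(x y)\<close>. This form is not symmetric: exchanging its arguments costs an application of
  the modular automorphism \<open>\<sigma> = Ad Q\<close>, so \<open>A\<close> must commute with \<open>\<sigma>\<close>. In coordinates the symmetry is
  \<open>w\<^sub>j a\<^sub>i\<^sub>j\<^sub>,\<^sub>k\<^sub>l = w\<^sub>l a\<^sub>l\<^sub>k\<^sub>,\<^sub>j\<^sub>i\<close> (\<open>undirected_transpose\<close>), and using it twice gives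
  \<open>(w\<^sub>j w\<^sub>k - w\<^sub>i w\<^sub>l) a\<^sub>i\<^sub>j\<^sub>,\<^sub>k\<^sub>l = 0\<close> (\<open>undirected_modular\<close>). For \<open>0 < q < 1\<close> the eigenspaces of \<open>\<sigma>\<close>
  are the diagonal matrices, \<open>\<complex> e\<^sub>1\<^sub>2\<close> and \<open>\<complex> e\<^sub>2\<^sub>1\<close>, with three different eigenvalues. Hence \<open>A\<close>
  preserves the diagonal and scales \<open>e\<^sub>1\<^sub>2\<close> and \<open>e\<^sub>2\<^sub>1\<close>, by the same factor \<open>a\<close>; on the diagonal only
  the matrix entries \<open>s, t, v\<close> are free, the remaining one being \<open>q\<^sup>2 t\<close> (\<open>undirected_block\<close>).

  Maps of this shape are closed under \<open>(A, B) \<mapsto> m(A \<otimes> B)m\<^sup>\<dagger>\<close>, so the two graph axioms become scalar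
  equations. Reflexivity expresses \<open>s\<close> and \<open>v\<close> through \<open>a\<close>; then idempotence reduces to
  \<open>a (1 - a) = 0\<close> and \<open>t (t - \<delta>/q) = 0\<close> (\<open>block_quantum_graph_iff\<close>). The two independent choices of
  \<open>a\<close> and \<open>t\<close> are the four graphs. In the orthonormal basis such a map decouples into the scalar
  \<open>a\<close>, twice, and a symmetric \<open>2 \<times> 2\<close> matrix, from which the spectra are read off
  (\<open>spectrum_block_matrix\<close>); regularity fails for the second and third graph because the row sums of
  that diagonal part are different.
\<close>

section \<open>Schur products of linear maps\<close>

lemma tensor_mult_entry: "tensor_mult T $ i $ j = (\<Sum>k\<in>UNIV. T $ (i, k) $ (k, j))"
proof -
  have "\<forall>i j. tensor_mult T $ i $ j = (\<Sum>k\<in>UNIV. T $ (i, k) $ (k, j))"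
    by (simp add: tensor_mult_def forall_2 sum_2 cscale_def matrix_unit_def matrix_matrix_mult_def)
  thus ?thesis by blast
qed

text \<open>
  Since \<open>m\<^sup>\<dagger> e\<^sub>i\<^sub>j = \<Sum>\<^sub>k w\<^sub>k\<^sup>-\<^sup>1 e\<^sub>i\<^sub>k \<otimes> e\<^sub>k\<^sub>j\<close>, the operation \<open>m(A \<otimes> B)m\<^sup>\<dagger>\<close>, the quantum analogue of the
  entrywise product of adjacency matrices, has the following explicit form.
\<close>

lemma schur_product_eq:
  assumes "0 < q"
  shows "tensor_mult (tensor_map A B (mult_adj q x)) =
    (\<Sum>i\<in>UNIV. \<Sum>j\<in>UNIV. \<Sum>k\<in>UNIV.
      (x $ i $ j / of_real (Q_weight q k)) *\<^sub>M (A (matrix_unit i k) ** B (matrix_unit k j)))"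
  by (simp add: mult_adj_eq assms mult_adj_expl_def vec_eq_iff forall_2 sum_2 tensor_mult_entry
        tensor_map_def kron_def cscale_def matrix_matrix_mult_def add_divide_distrib algebra_simps)

lemma clinear_map_eqI:
  fixes A B :: "M2 \<Rightarrow> M2"
  assumes "clinear_map A" "clinear_map B" "\<And>k l. A (matrix_unit k l) = B (matrix_unit k l)"
  shows "A = B"
  by (rule ext, subst clinear_expand[OF assms(1)], subst clinear_expand[OF assms(2)]) (simp add: assms(3))

section \<open>Modular invariance of undirected maps\<close>

lemma inner1_unit_left:
  "inner1 q (matrix_unit i j) y = of_real (Q_weight q j) * y $ i $ j"
proof -
  have "\<forall>i j. inner1 q (matrix_unit i j) y = of_real (Q_weight q j) * y $ i $ j"
    by (simp add: inner1_eq matrix_unit_def forall_2 sum_2)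
  thus ?thesis by blast
qed

lemma self_adjoint_iff:
  assumes "0 < q" "clinear_map A"
  shows "hilbert_adjoint (inner1 q) (inner1 q) A = A \<longleftrightarrow>
    (\<forall>x y. inner1 q (A x) y = inner1 q x (A y))"
proof
  assume "hilbert_adjoint (inner1 q) (inner1 q) A = A"
  thus "\<forall>x y. inner1 q (A x) y = inner1 q x (A y)"
    using hilbert_adjoint_inner1[OF assms] by simp
next
  assume *: "\<forall>x y. inner1 q (A x) y = inner1 q x (A y)"
  show "hilbert_adjoint (inner1 q) (inner1 q) A = A"
    by (rule ext, rule inner1_ext[OF assms(1)])
      (simp add: * hilbert_adjoint_inner1[OF assms, symmetric])
qed

lemma ctransp_matrix_unit: "ctransp (matrix_unit i j) = matrix_unit j i"
  by (auto simp: ctransp_def matrix_unit_def transpose_def vec_eq_iff)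

text \<open>
  Self-adjointness exchanges the index pairs of a coefficient up to a conjugation, and preservation
  of \<open>*\<close> undoes that conjugation at the price of transposing each pair.
\<close>

lemma undirected_transpose:
  assumes "0 < q" "clinear_map A" "undirected q A"
  shows "of_real (Q_weight q j) * A (matrix_unit k l) $ i $ j =
    of_real (Q_weight q l) * A (matrix_unit j i) $ l $ k"
proof -
  have "of_real (Q_weight q j) * A (matrix_unit k l) $ i $ j =
      inner1 q (matrix_unit i j) (A (matrix_unit k l))"
    by (simp add: inner1_unit_left)
  also have "\<dots> = cnj (inner1 q (matrix_unit k l) (A (matrix_unit i j)))"
    using assms self_adjoint_iff[OF assms(1,2)] by (simp add: undirected_def inner1_cnj)
  also have "\<dots> = of_real (Q_weight q l) * cnj (A (matrix_unit i j) $ k $ l)"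
    by (simp add: inner1_unit_left)
  also have "cnj (A (matrix_unit i j) $ k $ l) = ctransp (A (matrix_unit i j)) $ l $ k"
    by (simp add: ctransp_def transpose_def)
  also have "ctransp (A (matrix_unit i j)) = A (matrix_unit j i)"
    using assms(3) by (metis undirected_def ctransp_matrix_unit)
  finally show ?thesis .
qed

text \<open>
  The preceding symmetry squares to the identity on index pairs but not on weights: going around
  once multiplies the coefficient by \<open>w\<^sub>i w\<^sub>l / (w\<^sub>j w\<^sub>k)\<close>. This is commutation with \<open>Ad Q\<close>, whose
  eigenvalue on \<open>e\<^sub>k\<^sub>l\<close> is \<open>w\<^sub>k / w\<^sub>l\<close>.
\<close>

lemma undirected_modular:
  assumes "0 < q" "clinear_map A" "undirected q A"
    and "Q_weight q j * Q_weight q k \<noteq> Q_weight q i * Q_weight q l"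
  shows "A (matrix_unit k l) $ i $ j = 0"
proof -
  let ?w = "\<lambda>i. complex_of_real (Q_weight q i)" and ?a = "A (matrix_unit k l) $ i $ j"
  have "?w k * (?w j * ?a) = ?w l * (?w k * A (matrix_unit j i) $ l $ k)"
    using undirected_transpose[OF assms(1-3), of j k l i] by simp
  also have "\<dots> = ?w l * (?w i * ?a)"
    using undirected_transpose[OF assms(1-3), of k j i l] by simp
  finally have "(?w j * ?w k - ?w i * ?w l) * ?a = 0" by (simp add: algebra_simps)
  moreover have "?w j * ?w k \<noteq> ?w i * ?w l" using assms(4) by (simp flip: of_real_mult)
  ultimately show ?thesis by simp
qed

section \<open>Maps commuting with the modular automorphism\<close>

text \<open>
  For \<open>0 < q < 1\<close>, the general linear map commuting with \<open>Ad Q\<close>: \<open>a\<close> and \<open>b\<close> are the eigenvalues on \<open>e\<^sub>1\<^sub>2\<close> and \<open>e\<^sub>2\<^sub>1\<close>,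
  and \<open>s, t, u, v\<close> describe the restriction to the diagonal by \<open>e\<^sub>1\<^sub>1 \<mapsto> s e\<^sub>1\<^sub>1 + t e\<^sub>2\<^sub>2\<close> and
  \<open>e\<^sub>2\<^sub>2 \<mapsto> u e\<^sub>1\<^sub>1 + v e\<^sub>2\<^sub>2\<close>. Two separate eigenvalues \<open>a\<close> and \<open>b\<close> are kept because the Schur product of
  two maps with \<open>a = b\<close> need not be of that form.
\<close>

definition block :: "complex \<Rightarrow> complex \<Rightarrow> complex \<Rightarrow> complex \<Rightarrow> complex \<Rightarrow> complex \<Rightarrow> M2 \<Rightarrow> M2"
  where "block a b s t u v x = vector
    [vector [s * x $ 1 $ 1 + u * x $ 2 $ 2, a * x $ 1 $ 2],
     vector [b * x $ 2 $ 1, t * x $ 1 $ 1 + v * x $ 2 $ 2]]"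

lemma block_entries:
  "block a b s t u v x $ 1 $ 1 = s * x $ 1 $ 1 + u * x $ 2 $ 2"
  "block a b s t u v x $ 1 $ 2 = a * x $ 1 $ 2"
  "block a b s t u v x $ 2 $ 1 = b * x $ 2 $ 1"
  "block a b s t u v x $ 2 $ 2 = t * x $ 1 $ 1 + v * x $ 2 $ 2"
  by (simp_all add: block_def)

lemma clinear_block: "clinear_map (block a b s t u v)"
proof -
  have "vector_space (cscale :: complex \<Rightarrow> M2 \<Rightarrow> M2)" by (rule vector_space_cscale)
  thus ?thesis
    unfolding Vector_Spaces.linear_def module_hom_def module_hom_axioms_def vector_space_def module_def
    by (auto simp: vec_eq_iff forall_2 block_entries cscale_def algebra_simps)
qed

lemma block_eq_iff:
  "block a b s t u v = block a' b' s' t' u' v' \<longleftrightarrow>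
    a = a' \<and> b = b' \<and> s = s' \<and> t = t' \<and> u = u' \<and> v = v'" (is "?L \<longleftrightarrow> ?R")
proof
  assume L: ?L
  have "block a b s t u v (matrix_unit i j) $ k $ l = block a' b' s' t' u' v' (matrix_unit i j) $ k $ l" for i j k l
    by (simp add: L)
  from this[of 1 1 1 1] this[of 1 1 2 2] this[of 1 2 1 2] this[of 2 1 2 1] this[of 2 2 1 1] this[of 2 2 2 2]
  show ?R by (simp add: block_entries matrix_unit_def)
qed simp

lemma id_block: "id = block 1 1 1 0 0 1"
  by (simp add: fun_eq_iff vec_eq_iff forall_2 block_entries)

lemma cscale_block:
  "(\<lambda>x. c *\<^sub>M block a b s t u v x) = block (c * a) (c * b) (c * s) (c * t) (c * u) (c * v)"
  by (simp add: fun_eq_iff vec_eq_iff forall_2 block_entries cscale_def algebra_simps)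

lemma schur_product_block:
  fixes q :: real
  assumes "0 < q"
  defines "w \<equiv> \<lambda>i. complex_of_real (Q_weight q i)"
  shows "tensor_mult \<circ> tensor_map (block a b s t u v) (block a' b' s' t' u' v') \<circ> mult_adj q =
    block (s * a' / w 1 + a * v' / w 2) (b * s' / w 1 + v * b' / w 2)
      (s * s' / w 1 + a * b' / w 2) (t * t' / w 1) (u * u' / w 2) (b * a' / w 1 + v * v' / w 2)"
  by (simp add: fun_eq_iff schur_product_eq assms(1) vec_eq_iff forall_2 sum_2 block_entries cscale_def
     matrix_unit_def matrix_matrix_mult_def w_def algebra_simps)

lemma block_undirected:
  assumes "0 < q" "u = of_real (q\<^sup>2) * t" "a \<in> \<real>" "s \<in> \<real>" "t \<in> \<real>" "v \<in> \<real>"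
  shows "undirected q (block a a s t u v)"
proof -
  have c: "cnj a = a" "cnj s = s" "cnj t = t" "cnj v = v" using assms by (simp_all add: Reals_cnj_iff)
  have w: "Q_weight q 2 = q\<^sup>2 * Q_weight q 1" by (simp add: Q_weight_def)
  show ?thesis
    unfolding undirected_def self_adjoint_iff[OF assms(1) clinear_block]
    by (simp add: vec_eq_iff forall_2 block_entries ctransp_def transpose_def c assms(2) inner1_eq sum_2 w algebra_simps)
qed

text \<open>
  Modular invariance kills all ten coefficients outside the shape of a block; the transposition
  symmetry relates the surviving six.
\<close>

lemma undirected_block:
  assumes "0 < q" "q < 1" "clinear_map A" "undirected q A"
  shows "\<exists>a s t v. A = block a a s t (of_real (q\<^sup>2) * t) v"
proof -
  define c where "c i j k l = A (matrix_unit k l) $ i $ j" for i j k l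
  have w: "Q_weight q 2 = q\<^sup>2 * Q_weight q 1" by (simp add: Q_weight_def)
  have w1: "Q_weight q 1 > 0" using Q_weight_pos assms by blast
  have q: "q\<^sup>2 < 1" "q\<^sup>2 > 0" using assms by (simp_all add: power_less_one_iff)
  hence q4: "q\<^sup>2 * q\<^sup>2 < 1" by (smt (verit) mult_left_le)
  note m = undirected_modular[OF assms(1,3,4)]
  have z: "c 1 1 1 2 = 0" "c 1 1 2 1 = 0" "c 2 2 1 2 = 0" "c 2 2 2 1 = 0"
    "c 1 2 1 1 = 0" "c 1 2 2 2 = 0" "c 2 1 1 1 = 0" "c 2 1 2 2 = 0" "c 1 2 2 1 = 0" "c 2 1 1 2 = 0"
    unfolding c_def by (rule m, use w w1 q q4 in simp)+
  note t = undirected_transpose[OF assms(1,3,4), folded c_def]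
  have b: "c 2 1 2 1 = c 1 2 1 2" using t[where i = 1 and j = 2 and k = 1 and l = 2] w w1 q by simp
  have u: "c 1 1 2 2 = of_real (q\<^sup>2) * c 2 2 1 1" using t[where i = 1 and j = 1 and k = 2 and l = 2] w w1 q by simp
  have "A = block (c 1 2 1 2) (c 1 2 1 2) (c 1 1 1 1) (c 2 2 1 1) (of_real (q\<^sup>2) * c 2 2 1 1) (c 2 2 2 2)"
  proof (rule clinear_map_eqI[OF assms(3) clinear_block])
    have *: "\<forall>k l. A (matrix_unit k l) = block (c 1 2 1 2) (c 1 2 1 2) (c 1 1 1 1) (c 2 2 1 1) (of_real (q\<^sup>2) * c 2 2 1 1) (c 2 2 2 2) (matrix_unit k l)"
      unfolding vec_eq_iff forall_2 block_entries c_def[symmetric]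
      using z b u by (simp add: matrix_unit_def)
    show "A (matrix_unit k l) = block (c 1 2 1 2) (c 1 2 1 2) (c 1 1 1 1) (c 2 2 1 1) (of_real (q\<^sup>2) * c 2 2 1 1) (c 2 2 2 2) (matrix_unit k l)" for k l
      using * by blast
  qed
  thus ?thesis by blast
qed

section \<open>Classification\<close>

text \<open>
  With \<open>z = q\<^sup>2\<close> one has \<open>w\<^sub>1 = 1 / (1 + z)\<close>, \<open>w\<^sub>2 = z / (1 + z)\<close> and \<open>\<delta>\<^sup>2 = (1 + z)\<^sup>2 / z\<close>. The reflexivity
  equations are linear and determine \<open>s\<close> and \<open>v\<close>. After that substitution, each of the six idempotence
  equations is a nonzero multiple of \<open>a (1 - a) = 0\<close> or of \<open>t (t - \<delta>/q) = 0\<close>.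
\<close>

lemma block_quantum_graph_iff:
  fixes q :: real and a s t v :: complex
  assumes "0 < q"
  defines "A \<equiv> block a a s t (of_real (q\<^sup>2) * t) v"
  shows "quantum_graph q A \<and> reflexive q A \<longleftrightarrow>
    (a = 0 \<or> a = 1) \<and> (t = 0 \<or> t = of_real (delta q / q)) \<and>
    s = 1 + (1 - a) / of_real (q\<^sup>2) \<and> v = 1 + of_real (q\<^sup>2) * (1 - a)"
proof -
  define z where "z = complex_of_real (q\<^sup>2)"
  have z0: "z \<noteq> 0" using assms by (simp add: z_def)
  have "1 + q\<^sup>2 \<noteq> 0" by (smt (verit) zero_le_power2)
  hence z1: "1 + z \<noteq> 0" unfolding z_def by (metis of_real_1 of_real_add of_real_eq_0_iff)
  have w: "complex_of_real (Q_weight q 1) = 1 / (1 + z)" "complex_of_real (Q_weight q 2) = z / (1 + z)"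
    by (simp_all add: Q_weight_def z_def)
  have d: "complex_of_real ((delta q)\<^sup>2) = (1 + z)\<^sup>2 / z" 
  proof -
    have "(delta q)\<^sup>2 = (1 + q\<^sup>2)\<^sup>2 / q\<^sup>2" using assms by (simp add: delta_def field_simps power2_eq_square)
    thus ?thesis by (simp add: z_def)
  qed
  have dq: "complex_of_real (delta q / q) = (1 + z) / z"
  proof -
    have "delta q / q = (1 + q\<^sup>2) / q\<^sup>2" using assms by (simp add: delta_def field_simps power2_eq_square)
    thus ?thesis by (simp add: z_def)
  qed
  have R: "reflexive q A \<longleftrightarrow> s = 1 + (1 - a) / z \<and> v = 1 + z * (1 - a)"
  proof -
    have i: "(\<lambda>x. c *\<^sub>M x) = block c c c 0 0 c" for c :: complex
      using cscale_block[of c 1 1 1 0 0 1] by (simp flip: id_block)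
    have "reflexive q A \<longleftrightarrow> s * (1 + z) + a * (1 + z) / z = (1 + z)\<^sup>2 / z \<and>
         a * (1 + z) + v * (1 + z) / z = (1 + z)\<^sup>2 / z"
      unfolding reflexive_def A_def id_block schur_product_block[OF assms(1)] i block_eq_iff w d
      by auto
    also have "s * (1 + z) + a * (1 + z) / z = (1 + z)\<^sup>2 / z \<longleftrightarrow> s * z + a = 1 + z"
    proof -
      have "s * (1 + z) + a * (1 + z) / z - (1 + z)\<^sup>2 / z = (1 + z) / z * (s * z + a - (1 + z))"
        using z0 by (simp add: field_simps power2_eq_square)
      thus ?thesis using z0 z1 by (metis divide_eq_0_iff eq_iff_diff_eq_0 mult_eq_0_iff)
    qed
    also have "a * (1 + z) + v * (1 + z) / z = (1 + z)\<^sup>2 / z \<longleftrightarrow> a * z + v = 1 + z"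
    proof -
      have "a * (1 + z) + v * (1 + z) / z - (1 + z)\<^sup>2 / z = (1 + z) / z * (a * z + v - (1 + z))"
        using z0 by (simp add: field_simps power2_eq_square)
      thus ?thesis using z0 z1 by (metis divide_eq_0_iff eq_iff_diff_eq_0 mult_eq_0_iff)
    qed
    also have "s * z + a = 1 + z \<and> a * z + v = 1 + z \<longleftrightarrow> s = 1 + (1 - a) / z \<and> v = 1 + z * (1 - a)"
      using z0 by (auto simp: field_simps)
    finally show ?thesis .
  qed
  have Q: "quantum_graph q A \<longleftrightarrow> (a = 0 \<or> a = 1) \<and> (t = 0 \<or> t = (1 + z) / z)"
    if s: "s = 1 + (1 - a) / z" and v: "v = 1 + z * (1 - a)"
  proof -
    let ?d = "(1 + z)\<^sup>2 / z"
    \<comment> \<open>the constant factors by which the six equations differ from the two reduced ones\<close>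
    have nz: "?d \<noteq> 0" "- ?d / z \<noteq> 0" "- ?d * z \<noteq> 0" "z * (1 + z) \<noteq> 0"
      using z0 z1 by simp_all
    have e: "c = d \<longleftrightarrow> f" if "c - d = k * g" "k \<noteq> 0" "g = 0 \<longleftrightarrow> f" for c d k g :: complex and f
      using that by (metis eq_iff_diff_eq_0 mult_eq_0_iff)
    have "quantum_graph q A \<longleftrightarrow>
      s * a * (1 + z) + a * v * (1 + z) / z = ?d * a \<and>
      a * s * (1 + z) + v * a * (1 + z) / z = ?d * a \<and>
      s * s * (1 + z) + a * a * (1 + z) / z = ?d * s \<and>
      t * t * (1 + z) = ?d * t \<and>
      z * t * (z * t) * (1 + z) / z = ?d * (z * t) \<and>
      a * a * (1 + z) + v * v * (1 + z) / z = ?d * v"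
      unfolding quantum_graph_def A_def schur_product_block[OF assms(1)] cscale_block block_eq_iff w d
      by (simp add: clinear_block z_def)
    also have "s * a * (1 + z) + a * v * (1 + z) / z = ?d * a \<longleftrightarrow> a = 0 \<or> a = 1"
      by (rule e[OF _ nz(1), where g = "a * (1 - a)"])
        (use z0 z1 in \<open>simp add: s v field_simps power2_eq_square, auto\<close>)
    also have "a * s * (1 + z) + v * a * (1 + z) / z = ?d * a \<longleftrightarrow> a = 0 \<or> a = 1"
      by (rule e[OF _ nz(1), where g = "a * (1 - a)"])
        (use z0 z1 in \<open>simp add: s v field_simps power2_eq_square, auto\<close>)
    also have "s * s * (1 + z) + a * a * (1 + z) / z = ?d * s \<longleftrightarrow> a = 0 \<or> a = 1"
      by (rule e[OF _ nz(2), where g = "a * (1 - a)"])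
        (use z0 z1 in \<open>simp add: s v field_simps power2_eq_square, auto\<close>)
    also have "a * a * (1 + z) + v * v * (1 + z) / z = ?d * v \<longleftrightarrow> a = 0 \<or> a = 1"
      by (rule e[OF _ nz(3), where g = "a * (1 - a)"])
        (use z0 z1 in \<open>simp add: s v field_simps power2_eq_square, auto\<close>)
    also have "t * t * (1 + z) = ?d * t \<longleftrightarrow> t = 0 \<or> t = (1 + z) / z"
      by (rule e[OF _ z1, where g = "t * (t - (1 + z) / z)"])
        (use z0 z1 in \<open>simp add: field_simps power2_eq_square, auto\<close>)
    also have "z * t * (z * t) * (1 + z) / z = ?d * (z * t) \<longleftrightarrow> t = 0 \<or> t = (1 + z) / z"
      by (rule e[OF _ nz(4), where g = "t * (t - (1 + z) / z)"])
        (use z0 z1 in \<open>simp add: field_simps power2_eq_square, auto\<close>)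
    finally show ?thesis by blast
  qed
  show ?thesis unfolding dq z_def[symmetric] using R Q by blast
qed

section \<open>Matrices and spectra of blocks\<close>

text \<open>
  The basis vectors \<open>e\<^sub>1\<^sub>1 Q\<^sup>-\<^sup>1\<^sup>/\<^sup>2\<close> and \<open>e\<^sub>2\<^sub>2 Q\<^sup>-\<^sup>1\<^sup>/\<^sup>2\<close> are multiples of \<open>e\<^sub>1\<^sub>1\<close> and \<open>e\<^sub>2\<^sub>2\<close> whose ratio involves
  \<open>(w\<^sub>2 / w\<^sub>1)\<^sup>1\<^sup>/\<^sup>2 = q\<close>; this is the factor by which the two off-diagonal entries change.
\<close>

lemma op_of_matrix_block:
  assumes "0 < q"
  shows "op_of_matrix q (vector
          [vector [\<alpha>, 0, 0, \<beta>], vector [0, \<gamma>, 0, 0],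
           vector [0, 0, \<gamma>, 0], vector [\<beta>, 0, 0, \<eta>]]) =
    block \<gamma> \<gamma> \<alpha> (\<beta> / of_real q) (\<beta> * of_real q) \<eta>"
proof -
  define p where "p = Q_weight q 1 powr (-(1/2))"
  define r where "r = Q_weight q 2 powr (-(1/2))"
  have w2: "Q_weight q 2 = q\<^sup>2 * Q_weight q 1" by (simp add: Q_weight_def)
  have "(q\<^sup>2) powr (-(1/2)) = inverse q"
    using assms by (simp add: powr_minus powr_half_sqrt)
  hence r: "r = p / q" using assms Q_weight_pos[OF assms, of 1]
    by (simp add: r_def p_def w2 powr_mult field_simps)
  have p1: "complex_of_real p * (of_real p * (of_real (Q_weight q 1) * y)) = y"
    "complex_of_real p * (of_real p * of_real (Q_weight q 1)) = 1" for y
    using Q_weight_powr[OF assms, of 1] by (simp_all add: p_def mult_ac)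
  have o: "onb q $ 1 = of_real p *\<^sub>M matrix_unit 1 1" "onb q $ 2 = of_real r *\<^sub>M matrix_unit 1 2"
    "onb q $ 3 = of_real p *\<^sub>M matrix_unit 2 1" "onb q $ 4 = of_real r *\<^sub>M matrix_unit 2 2"
    by (simp_all add: vector_4 onb_def sum_2 matrix_unit_def matrix_matrix_mult_def Q_power_def
      cscale_def vec_eq_iff forall_2 p_def r_def)
  have i: "inner1 q (of_real c *\<^sub>M matrix_unit k l) y =
      of_real c * (of_real (Q_weight q l) * y $ k $ l)" for c k l y
  proof -
    have "inner1 q (of_real c *\<^sub>M matrix_unit k l) y = of_real c * inner1 q (matrix_unit k l) y"
      by (simp add: inner1_eq sum_2 cscale_def algebra_simps)
    thus ?thesis by (simp only: inner1_unit_left)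
  qed
  show ?thesis
    unfolding fun_eq_iff op_of_matrix_def sum_4 vector_4 o i
    using assms
    by (simp add: vec_eq_iff forall_2 block_entries cscale_def matrix_unit_def r w2 power2_eq_square
      p1 algebra_simps)
qed

lemma det_4:
  fixes A :: "'a::comm_ring_1^4^4"
  shows "det A = 
      A$1$1 * (A$2$2 * (A$3$3 * A$4$4 - A$3$4 * A$4$3) - A$2$3 * (A$3$2 * A$4$4 - A$3$4 * A$4$2)
        + A$2$4 * (A$3$2 * A$4$3 - A$3$3 * A$4$2))
    - A$1$2 * (A$2$1 * (A$3$3 * A$4$4 - A$3$4 * A$4$3) - A$2$3 * (A$3$1 * A$4$4 - A$3$4 * A$4$1)
        + A$2$4 * (A$3$1 * A$4$3 - A$3$3 * A$4$1))
    + A$1$3 * (A$2$1 * (A$3$2 * A$4$4 - A$3$4 * A$4$2) - A$2$2 * (A$3$1 * A$4$4 - A$3$4 * A$4$1)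
        + A$2$4 * (A$3$1 * A$4$2 - A$3$2 * A$4$1))
    - A$1$4 * (A$2$1 * (A$3$2 * A$4$3 - A$3$3 * A$4$2) - A$2$2 * (A$3$1 * A$4$3 - A$3$3 * A$4$1)
        + A$2$3 * (A$3$1 * A$4$2 - A$3$2 * A$4$1))"
proof -
  have f1234: "finite {2::4, 3, 4}" "1 \<notin> {2::4, 3, 4}" by auto
  have f234: "finite {3::4, 4}" "2 \<notin> {3::4, 4}" by auto
  have f34: "finite {4::4}" "3 \<notin> {4::4}" by auto
  show ?thesis
    unfolding det_def UNIV_4
    unfolding sum_over_permutations_insert[OF f1234]
    unfolding sum_over_permutations_insert[OF f234]
    unfolding sum_over_permutations_insert[OF f34]
    unfolding permutes_sing
    by (simp add: sign_swap_id permutation_swap_id permutation_compose sign_compose sign_id swap_id_eq algebra_simps)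
qed

lemma charpoly_block_matrix:
  fixes \<alpha> :: complex
  shows "charpoly (vector
          [vector [\<alpha>, 0, 0, \<beta>], vector [0, \<gamma>, 0, 0],
           vector [0, 0, \<gamma>, 0], vector [\<beta>, 0, 0, \<eta>]] :: complex^4^4) =
    [:-\<gamma>, 1:] * [:-\<gamma>, 1:] * ([:-\<alpha>, 1:] * [:-\<eta>, 1:] - [:\<beta> * \<beta>:])"
  unfolding charpoly_def det_4 by (simp add: vector_4 mat_def algebra_simps)

text \<open>
  The eigenvalues of the \<open>2 \<times> 2\<close> part are given by their sum and product, that is, by its trace and
  determinant, so that no quadratic equation has to be solved.
\<close>

lemma spectrum_block_matrix:
  assumes "0 < q" "\<kappa> + \<mu> = \<alpha> + \<eta>" "\<kappa> * \<mu> = \<alpha> * \<eta> - \<beta> * \<beta>"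
  shows "spectrum q (op_of_matrix q (vector
          [vector [\<alpha>, 0, 0, \<beta>], vector [0, \<gamma>, 0, 0],
           vector [0, 0, \<gamma>, 0], vector [\<beta>, 0, 0, \<eta>]])) = {#\<kappa>, \<mu>, \<gamma>, \<gamma>#}"
proof -
  have "[:-\<alpha>, 1:] * [:-\<eta>, 1:] - [:\<beta> * \<beta>:] = [:-\<kappa>, 1:] * [:-\<mu>, 1:]"
    using assms(2,3) by (simp add: algebra_simps)
  thus ?thesis
    by (simp add: spectrum_def op_matrix_of[OF assms(1)] charpoly_block_matrix proots_mult
      del: mult_pCons_left mult_pCons_right)
qed

text \<open>The row sums are the diagonal entries of the image of \<open>1\<close>, which regularity makes scalar.\<close>

lemma regular_block_row_sums: "regular q d (block a b s t u v) \<Longrightarrow> s + u = t + v"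
  by (simp add: regular_def vec_eq_iff forall_2 block_entries cscale_def mat_def)

section \<open>The four graphs\<close>

theorem theorem3p5:
  fixes q \<delta> :: real and A1 A2 A3 A4 :: "M2 \<Rightarrow> M2"
  assumes "0 < q" and "q < 1"
    and "\<delta> = delta q"
    and "A1 = id"
    and "A2 = op_of_matrix q (vector
          [vector [of_real (inverse q * \<delta>), 0, 0, 0],
           vector [0, 0, 0, 0],
           vector [0, 0, 0, 0],
           vector [0, 0, 0, of_real (q * \<delta>)]])"
    and "A3 = op_of_matrix q (vector
          [vector [1, 0, 0, of_real \<delta>],
           vector [0, 1, 0, 0],
           vector [0, 0, 1, 0],
           vector [of_real \<delta>, 0, 0, 1]])"
    and "A4 = (\<lambda>x. (of_real (\<delta>\<^sup>2) * powers_state q x) *\<^sub>M mat 1)"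
  shows
    "(\<forall>A. quantum_graph q A \<and> undirected q A \<and> reflexive q A \<longleftrightarrow>
        A = A1 \<or> A = A2 \<or> A = A3 \<or> A = A4) \<and>
     distinct [A1, A2, A3, A4] \<and>
     (regular q 1 A1 \<and> spectrum q A1 = {#1, 1, 1, 1#}) \<and>
     (irregular q A2 \<and>
        spectrum q A2 = {#of_real (inverse q * \<delta>), of_real (q * \<delta>), 0, 0#}) \<and>
     (irregular q A3 \<and>
        spectrum q A3 = {#of_real (1 + \<delta>), 1, 1, of_real (1 - \<delta>)#}) \<and>
     (A4 = op_of_matrix q (vector
          [vector [of_real (inverse q * \<delta>), 0, 0, of_real \<delta>],
           vector [0, 0, 0, 0],
           vector [0, 0, 0, 0],
           vector [of_real \<delta>, 0, 0, of_real (q * \<delta>)]]) \<and>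
        regular q (of_real (\<delta>\<^sup>2)) A4 \<and>
        spectrum q A4 = {#of_real (\<delta>\<^sup>2), 0, 0, 0#})"
proof -
  note q = assms(1,2) and def = assms(3-7)
  have q2: "q\<^sup>2 < 1" "0 < q\<^sup>2" using q by (simp_all add: power_less_one_iff)
  have \<delta>: "\<delta> = q + 1 / q" "0 < \<delta>" using q by (simp_all add: def(1) delta_def divide_inverse add_pos_pos)
  let ?c = complex_of_real
  let ?Z = "?c (q\<^sup>2)"
  \<comment> \<open>the common form of the four graphs, left by the classification of blocks\<close>
  let ?B = "\<lambda>a t. block a a (1 + (1 - a) / ?Z) t (?Z * t) (1 + ?Z * (1 - a))"
  have c: "1 + 1 / ?Z = ?c (\<delta> / q)" "1 + ?Z = ?c (\<delta> * q)"
    "?Z * ?c (\<delta> / q) = ?c (\<delta> * q)" "?c (\<delta>\<^sup>2) * ?c (Q_weight q 1) = ?c (\<delta> / q)" 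
    "?c (\<delta>\<^sup>2) * ?c (Q_weight q 2) = ?c (\<delta> * q)" 
  proof -
    have "1 + 1 / q\<^sup>2 = \<delta> / q" "1 + q\<^sup>2 = \<delta> * q" "q\<^sup>2 * (\<delta> / q) = \<delta> * q"
      using q by (simp_all add: \<delta>(1) power2_eq_square field_simps)
    moreover have "\<delta>\<^sup>2 * Q_weight q 1 = \<delta> / q" "\<delta>\<^sup>2 * Q_weight q 2 = \<delta> * q"
    proof -
      have "Q_weight q 1 = 1 / (\<delta> * q)" "Q_weight q 2 = q\<^sup>2 / (\<delta> * q)"
        using \<open>1 + q\<^sup>2 = \<delta> * q\<close> by (simp_all add: Q_weight_def)
      thus "\<delta>\<^sup>2 * Q_weight q 1 = \<delta> / q" "\<delta>\<^sup>2 * Q_weight q 2 = \<delta> * q"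
        using q \<delta>(2) by (simp_all add: power2_eq_square)
    qed
    ultimately show "1 + 1 / ?Z = ?c (\<delta> / q)" "1 + ?Z = ?c (\<delta> * q)"
      "?Z * ?c (\<delta> / q) = ?c (\<delta> * q)" "?c (\<delta>\<^sup>2) * ?c (Q_weight q 1) = ?c (\<delta> / q)" 
      "?c (\<delta>\<^sup>2) * ?c (Q_weight q 2) = ?c (\<delta> * q)" 
      by (metis of_real_1 of_real_add of_real_divide of_real_mult)+
  qed
  have A1: "A1 = ?B 1 0" by (simp add: def id_block)
  note B_simps = c diff_zero diff_self div_0 add_0_right mult_zero_right mult_1_right
  have A2b: "A2 = block 0 0 (?c (\<delta> / q)) 0 0 (?c (\<delta> * q))"
    by (simp add: def(3) op_of_matrix_block[OF q(1)] block_eq_iff divide_inverse mult_ac)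
  hence A2: "A2 = ?B 0 0" by (simp only: B_simps)
  have A3b: "A3 = block 1 1 1 (?c (\<delta> / q)) (?c (\<delta> * q)) 1"
    by (simp add: def(4) op_of_matrix_block[OF q(1)] block_eq_iff)
  hence A3: "A3 = ?B 1 (?c (\<delta> / q))" by (simp only: B_simps)
  have A4: "A4 = ?B 0 (?c (\<delta> / q))"
  proof -
    have "A4 = block 0 0 (?c (\<delta>\<^sup>2) * ?c (Q_weight q 1)) (?c (\<delta>\<^sup>2) * ?c (Q_weight q 1))
        (?c (\<delta>\<^sup>2) * ?c (Q_weight q 2)) (?c (\<delta>\<^sup>2) * ?c (Q_weight q 2))"
      by (simp add: def(5) fun_eq_iff vec_eq_iff forall_2 block_entries cscale_def mat_def powers_state_def
         trace_def matrix_matrix_mult_def Q_density_def sum_2 algebra_simps)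
    thus ?thesis by (simp only: B_simps)
  qed
  have "A4 = block 0 0 (?c (\<delta> / q)) (?c (\<delta> / q)) (?c (\<delta> * q)) (?c (\<delta> * q))"
    using A4 by (simp only: B_simps)
  hence A4m: "A4 = op_of_matrix q (vector
          [vector [of_real (inverse q * \<delta>), 0, 0, of_real \<delta>],
           vector [0, 0, 0, 0],
           vector [0, 0, 0, 0],
           vector [of_real \<delta>, 0, 0, of_real (q * \<delta>)]])"
    by (simp add: op_of_matrix_block[OF q(1)] block_eq_iff divide_inverse mult_ac)
  have A1m: "A1 = op_of_matrix q (vector
          [vector [1, 0, 0, 0], vector [0, 1, 0, 0], vector [0, 0, 1, 0], vector [0, 0, 0, 1]])"
    by (simp add: A1 op_of_matrix_block[OF q(1)] block_eq_iff)
  have classification: "quantum_graph q A \<and> undirected q A \<and> reflexive q A \<longleftrightarrow>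
        A = A1 \<or> A = A2 \<or> A = A3 \<or> A = A4" for A
  proof
    assume L: "quantum_graph q A \<and> undirected q A \<and> reflexive q A"
    then obtain a s t v where A: "A = block a a s t (?Z * t) v"
      using undirected_block[OF q, of A] unfolding quantum_graph_def by blast
    show "A = A1 \<or> A = A2 \<or> A = A3 \<or> A = A4"
      using L block_quantum_graph_iff[OF q(1), of a s t v]
      unfolding A A1 A2 A3 A4 def(1)[symmetric] by auto
  next
    assume "A = A1 \<or> A = A2 \<or> A = A3 \<or> A = A4"
    then obtain a t where A: "A = ?B a t" and at: "a = 0 \<or> a = 1" "t = 0 \<or> t = ?c (\<delta> / q)"
      unfolding A1 A2 A3 A4 by blast
    have "undirected q A"
      unfolding A by (rule block_undirected) (use q at in auto)
    thus "quantum_graph q A \<and> undirected q A \<and> reflexive q A"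
      using at block_quantum_graph_iff[OF q(1), of a _ t] unfolding A def(1)[symmetric] by blast
  qed
  have "?c (\<delta> / q) \<noteq> 0" using q \<delta>(2) by simp
  hence dist: "distinct [A1, A2, A3, A4]"
    unfolding A1 A2 A3 A4 by (simp add: block_eq_iff)
  have ne: "?c (\<delta> / q) \<noteq> ?c (\<delta> * q)"
    using q q2 \<delta>(2) by (simp add: field_simps power2_eq_square del: of_real_mult of_real_divide)
  have irr: "irregular q A2" "irregular q A3"
    unfolding irregular_def A2b A3b using ne
    by (auto dest!: regular_block_row_sums simp: add.commute)
  have reg: "regular q 1 A1" "regular q (of_real (\<delta>\<^sup>2)) A4"
  proof -
    show "regular q 1 A1" by (simp add: regular_def def(2) fun_eq_iff cscale_def vec_eq_iff)
    have "1 + q\<^sup>2 \<noteq> 0" using q2 by linarith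
    hence "Q_weight q 1 + Q_weight q 2 = 1" by (simp add: Q_weight_def flip: add_divide_distrib)
    hence "powers_state q (mat 1) = 1"
      by (simp add: powers_state_def trace_def Q_density_def sum_2 flip: of_real_add)
    moreover have "powers_state q (c *\<^sub>M x) = c * powers_state q x" for c x
      by (simp add: powers_state_def trace_def matrix_matrix_mult_def cscale_def sum_2 algebra_simps)
    ultimately show "regular q (of_real (\<delta>\<^sup>2)) A4"
      by (simp add: regular_def def(5) fun_eq_iff)
  qed
  have D: "\<delta> * \<delta> = \<delta> / q + \<delta> * q"
    using arg_cong[OF \<delta>(1), of "\<lambda>x. \<delta> * x"] by (simp add: algebra_simps)
  have D': "?c \<delta> * ?c \<delta> = ?c \<delta> / ?c q + ?c \<delta> * ?c q"
    using arg_cong[OF D, of ?c] by simp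
  have sp1: "spectrum q A1 = {#1, 1, 1, 1#}"
    unfolding A1m by (rule spectrum_block_matrix) (use q in simp_all)
  have sp2: "spectrum q A2 = {#of_real (inverse q * \<delta>), of_real (q * \<delta>), 0, 0#}"
    unfolding def(3) by (rule spectrum_block_matrix) (use q in simp_all)
  have sp3: "spectrum q A3 = {#of_real (1 + \<delta>), of_real (1 - \<delta>), 1, 1#}"
    unfolding def(4) by (rule spectrum_block_matrix) (use q in \<open>simp_all add: algebra_simps\<close>)
  have sp4: "spectrum q A4 = {#of_real (\<delta>\<^sup>2), 0, 0, 0#}"
    unfolding A4m
    by (rule spectrum_block_matrix) (use q D' in \<open>simp_all add: power2_eq_square field_simps\<close>)
  show ?thesis
    using classification dist irr reg sp1 sp2 sp3 sp4 A4m by (simp add: add_mset_commute)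
qed

end
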